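(* Let $a\in\mathbb{R}$, $0<\alpha\le1$, and let $f:[a,\infty)\to\mathbb{R}$ be a real-valued function that is differentiable on $(a,\infty)$. Then $$L_\alpha^a\{T_\alpha^a (f)(t)\}(s)=s\,F_\alpha^a(s)-f(a).$$
   Context: For $0<\alpha\le1$, the left conformable fractional derivative of order $\alpha$ starting from $a$ is $$(T_\alpha^a f)(t)=\lim_{\epsilon\to0}\frac{f(t+\epsilon (t-a)^{1-\alpha})-f(t)}{\epsilon}.$$ The fractional Laplace transform of order $\alpha$ starting from $a$ of a real-valued function $f$ on $[a,\infty)$ is $$L_\alpha^{a}\{f(t)\}(s)=F_\alpha^{a}(s)=\int_{a}^\infty e^{-s\frac{(t-a)^\alpha}{\alpha}}f(t)\,(t-a)^{\alpha-1}\,dt .$$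
   Formalization: The formal statement additionally assumes that f is continuous from the right at a (false otherwise: f(a)=1, f=0 on (a,∞)) and that both transforms, of f and of its conformable derivative, exist at s. *)

theory Defs
  imports "HOL-Analysis.Analysis"
begin

text \<open>Functions on $[a,\infty)$ are total functions on the reals whose values to the left of
  $a$ are irrelevant. For $t > a$ the limit below only involves values of $f$ close to $t$; the value
  at the single point $t = a$ plays no role under the integral.\<close>

definition conformable_deriv :: "real \<Rightarrow> real \<Rightarrow> (real \<Rightarrow> real) \<Rightarrow> real \<Rightarrow> real" where
  "conformable_deriv \<alpha> a f t =
     Lim (at 0) (\<lambda>\<epsilon>. (f (t + \<epsilon> * (t - a) powr (1 - \<alpha>)) - f t) / \<epsilon>)"

definition frac_laplace_integrand ::
    "real \<Rightarrow> real \<Rightarrow> (real \<Rightarrow> real) \<Rightarrow> real \<Rightarrow> real \<Rightarrow> real" where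
  "frac_laplace_integrand \<alpha> a f s t =
     exp (- s * ((t - a) powr \<alpha> / \<alpha>)) * f t * (t - a) powr (\<alpha> - 1)"

text \<open>The integral over $[a,\infty)$ is the Henstock--Kurzweil integral. It agrees with the Lebesgue
  integral and with (conditionally convergent) improper Riemann integrals at $a$ and at $\infty$
  whenever those exist, so the existence predicate below is the weakest of the usual ones.\<close>

definition frac_laplace_exists :: "real \<Rightarrow> real \<Rightarrow> (real \<Rightarrow> real) \<Rightarrow> real \<Rightarrow> bool" where
  "frac_laplace_exists \<alpha> a f s \<longleftrightarrow> frac_laplace_integrand \<alpha> a f s integrable_on {a..}"

definition frac_laplace :: "real \<Rightarrow> real \<Rightarrow> (real \<Rightarrow> real) \<Rightarrow> real \<Rightarrow> real" where
  "frac_laplace \<alpha> a f s = integral {a..} (frac_laplace_integrand \<alpha> a f s)"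

end

theory Submission
  imports Defs "HOL-Real_Asymp.Real_Asymp"
begin

text \<open>For $t > a$ the conformable derivative is $(t-a)^{1-\alpha} f'(t)$, so with
  $u = (t-a)^\alpha/\alpha$ and $G(t) = e^{-su} f(t)$ one has $G' = g_2 - s g_1$, where $g_1$ and
  $g_2$ are the integrands of the transforms of $f$ and of its conformable derivative. Integrating
  over $[a,x]$ shows that $G$ has a limit $L$ at infinity and that the claim holds up to the extra
  term $L$. Since $g_1\,dt = G\,du$ has a convergent integral and $u \to \infty$, the limit $L$ must be $0$.\<close>

text \<open>The Henstock-Kurzweil integral over an unbounded set is a limit over all boxes
  containing a large ball. The boxes used here have a fixed left end and a growing right end
  \<open>x\<close>.\<close>

lemma tendsto_integral_at_top:
  fixes g :: "real \<Rightarrow> 'a::banach"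
  assumes "g integrable_on {a..}"
  shows "((\<lambda>x. integral {a..x} g) \<longlongrightarrow> integral {a..} g) at_top"
proof (rule tendstoI)
  fix e :: real assume "e > 0"
  let ?h = "\<lambda>x. if x \<in> {a..} then g x else 0"
  have "(g has_integral integral {a..} g) {a..}"
    using assms by blast
  with \<open>e > 0\<close> obtain B where "B > 0"
    and B: "\<And>c d. ball 0 B \<subseteq> cbox c d \<Longrightarrow> norm (integral (cbox c d) ?h - integral {a..} g) < e"
    unfolding has_integral_alt' by meson
  show "\<forall>\<^sub>F x in at_top. dist (integral {a..x} g) (integral {a..} g) < e"
    using eventually_ge_at_top[of "max B a"]
  proof eventually_elim
    case (elim x)
    \<comment> \<open>The bound \<open>- B\<close> lets the box cover the ball, and the bound
      \<open>a\<close> makes its intersection with \<open>{a..}\<close> equal to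
      \<open>{a..x}\<close>; the zero extension contributes nothing to the left of
      \<open>a\<close>.\<close>
    define c where "c = min a (- B)"
    have "ball 0 B \<subseteq> cbox c x"
      using elim by (auto simp: c_def dist_real_def)
    from B[OF this] have "norm (integral {c..x} ?h - integral {a..} g) < e"
      by simp
    moreover have "{a..} \<inter> {c..x} = {a..x}"
      by (auto simp: c_def)
    then have "integral {c..x} ?h = integral {a..x} g"
      using integral_restrict_Int[of "{c..x}" "{a..}" g] by (simp only:)
    ultimately show ?case
      by (simp only: dist_norm)
  qed
qed

lemma integrable_on_atLeastAtMost_if_atLeast:
  fixes g :: "real \<Rightarrow> 'a::banach"
  assumes "g integrable_on {a..}" "a \<le> c"
  shows "g integrable_on {c..d}"
  using integrable_on_subinterval[OF assms(1), of c d] assms(2) by auto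

text \<open>A positive limit would keep \<open>G\<close> above \<open>L / 2\<close> from some point
  on, so the integral of \<open>w * G\<close> would grow at least like \<open>L / 2\<close> times
  \<open>\<phi>\<close>, hence without bound.\<close>

lemma limit_nonpos_if_weighted_integrable:
  fixes G w \<phi> :: "real \<Rightarrow> real"
  assumes deriv: "\<And>x. x > a \<Longrightarrow> (\<phi> has_real_derivative w x) (at x)"
    and nonneg: "\<And>x. x > a \<Longrightarrow> 0 \<le> w x"
    and infty: "filterlim \<phi> at_top at_top"
    and int: "(\<lambda>x. w x * G x) integrable_on {a..}"
    and lim: "(G \<longlongrightarrow> L) at_top"
  shows "L \<le> 0"
proof (rule ccontr)
  assume "\<not> L \<le> 0"
  define c where "c = L / 2"
  have "c > 0" "c < L"
    using \<open>\<not> L \<le> 0\<close> by (auto simp: c_def)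
  let ?I = "\<lambda>x. integral {a..x} (\<lambda>x. w x * G x)"
  have "\<forall>\<^sub>F x in at_top. G x > c \<and> x > a"
    using order_tendstoD(1)[OF lim \<open>c < L\<close>] eventually_gt_at_top by (rule eventually_conj)
  then obtain T where T: "\<And>x. x \<ge> T \<Longrightarrow> G x > c \<and> x > a"
    by (auto simp: eventually_at_top_linorder)
  have "T > a"
    using T by blast
  \<comment> \<open>The integral is split at \<open>T\<close>; beyond it \<open>G\<close> exceeds
    \<open>c\<close>, and the weight \<open>w\<close> integrates to the increment of
    \<open>\<phi>\<close>.\<close>
  have lower: "?I T + c * (\<phi> x - \<phi> T) \<le> ?I x" if "x \<ge> T" for x
  proof -
    have w: "(w has_integral (\<phi> x - \<phi> T)) {T..x}"
      using that T
      by (intro fundamental_theorem_of_calculus)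
         (auto intro!: has_field_derivative_at_within deriv
               simp flip: has_real_derivative_iff_has_vector_derivative)
    have "((\<lambda>x. w x * c) has_integral ((\<phi> x - \<phi> T) * c)) {T..x}"
      using w by (rule has_integral_mult_left)
    moreover have int': "(\<lambda>x. w x * G x) integrable_on {T..x}"
      using int \<open>T > a\<close> by (intro integrable_on_atLeastAtMost_if_atLeast) auto
    moreover have "w y * c \<le> w y * G y" if "y \<in> {T..x}" for y
      using T[of y] nonneg[of y] that by (intro mult_left_mono) auto
    ultimately have "(\<phi> x - \<phi> T) * c \<le> integral {T..x} (\<lambda>x. w x * G x)"
      by (intro has_integral_le[OF _ integrable_integral[OF int']])
    moreover have "?I T + integral {T..x} (\<lambda>x. w x * G x) = ?I x"
      using \<open>T > a\<close> that integrable_on_atLeastAtMost_if_atLeast[OF int order.refl]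
      by (intro Henstock_Kurzweil_Integration.integral_combine) auto
    ultimately show ?thesis
      by (simp add: mult.commute)
  qed
  have "LIM x at_top. (?I T - c * \<phi> T) + c * \<phi> x :> at_top"
    using \<open>c > 0\<close> infty
    by (intro filterlim_tendsto_add_at_top[OF tendsto_const]
              filterlim_tendsto_pos_mult_at_top[OF tendsto_const])
  then have "LIM x at_top. ?I x :> at_top"
    by (rule filterlim_at_top_mono)
       (use lower in \<open>auto simp: eventually_at_top_linorder algebra_simps intro!: exI[of _ T]\<close>)
  then have "LIM x at_top. ?I x :> at_infinity"
    by (rule filterlim_at_top_imp_at_infinity)
  with tendsto_integral_at_top[OF int] show False
    by (intro not_tendsto_and_filterlim_at_infinity[OF trivial_limit_at_top_linorder])
qed

text \<open>The one-sided bound applies to both \<open>G\<close> and \<open>- G\<close>.\<close>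

lemma limit_eq_0_if_weighted_integrable:
  fixes G w \<phi> :: "real \<Rightarrow> real"
  assumes deriv: "\<And>x. x > a \<Longrightarrow> (\<phi> has_real_derivative w x) (at x)"
    and nonneg: "\<And>x. x > a \<Longrightarrow> 0 \<le> w x"
    and infty: "filterlim \<phi> at_top at_top"
    and int: "(\<lambda>x. w x * G x) integrable_on {a..}"
    and lim: "(G \<longlongrightarrow> L) at_top"
  shows "L = 0"
proof (rule antisym)
  show "L \<le> 0"
    by (rule limit_nonpos_if_weighted_integrable[OF deriv nonneg infty int lim])
  have int': "(\<lambda>x. w x * - G x) integrable_on {a..}"
    using integrable_neg[OF int] by simp
  have "- L \<le> 0"
    by (rule limit_nonpos_if_weighted_integrable[OF deriv nonneg infty int' tendsto_minus[OF lim]])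
  then show "0 \<le> L"
    by simp
qed

text \<open>The defining quotient is the ordinary difference quotient at 0 of \<open>f\<close>
  composed with an affine map of slope \<open>k\<close>, so the chain rule gives its limit.\<close>

lemma conformable_deriv_eq:
  assumes "t > a" and "(f has_real_derivative D) (at t)"
  shows "conformable_deriv \<alpha> a f t = (t - a) powr (1 - \<alpha>) * D"
proof -
  define k where "k = (t - a) powr (1 - \<alpha>)"
  have "((\<lambda>\<epsilon>. t + \<epsilon> * k) has_real_derivative k) (at 0)"
    by (auto intro!: derivative_eq_intros)
  then have "((\<lambda>\<epsilon>. f (t + \<epsilon> * k)) has_real_derivative D * k) (at 0)"
    using assms(2) by (intro DERIV_chain2[of f]) auto
  then have "((\<lambda>\<epsilon>. (f (t + \<epsilon> * k) - f t) / \<epsilon>) \<longlongrightarrow> D * k) (at 0)"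
    by (simp add: DERIV_def)
  then show ?thesis
    unfolding conformable_deriv_def k_def[symmetric]
    by (simp add: tendsto_Lim mult.commute)
qed

lemma has_real_derivative_conformable_phase:
  fixes a \<alpha> t :: real
  assumes "\<alpha> \<noteq> 0" "t > a"
  shows "((\<lambda>t. (t - a) powr \<alpha> / \<alpha>) has_real_derivative (t - a) powr (\<alpha> - 1)) (at t)"
  using assms by (auto intro!: derivative_eq_intros)

theorem theorem5p1:
  fixes a \<alpha> s :: real and f :: "real \<Rightarrow> real"
  assumes "0 < \<alpha>" and "\<alpha> \<le> 1"
    and "f differentiable_on {a<..}"
    and "continuous (at_right a) f"
    and "frac_laplace_exists \<alpha> a f s"
    and "frac_laplace_exists \<alpha> a (conformable_deriv \<alpha> a f) s"
  shows "frac_laplace \<alpha> a (conformable_deriv \<alpha> a f) s = s * frac_laplace \<alpha> a f s - f a"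
proof -
  define \<phi> where "\<phi> t = (t - a) powr \<alpha> / \<alpha>" for t
  define w where "w t = (t - a) powr (\<alpha> - 1)" for t
  define G where "G t = exp (- s * \<phi> t) * f t" for t
  define g1 where "g1 = frac_laplace_integrand \<alpha> a f s"
  define g2 where "g2 = frac_laplace_integrand \<alpha> a (conformable_deriv \<alpha> a f) s"
  have int1: "g1 integrable_on {a..}" and int2: "g2 integrable_on {a..}"
    using assms(5,6) by (auto simp: g1_def g2_def frac_laplace_exists_def)
  have g1: "g1 = (\<lambda>t. w t * G t)"
    by (simp add: g1_def frac_laplace_integrand_def w_def G_def \<phi>_def fun_eq_iff)
  have \<phi>_deriv: "(\<phi> has_real_derivative w t) (at t)" if "t > a" for t
    unfolding \<phi>_def w_def using assms(1) that
    by (intro has_real_derivative_conformable_phase) auto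
  have f_deriv: "(f has_real_derivative deriv f t) (at t)" if "t > a" for t
  proof -
    have "f differentiable (at t)"
      using assms(3) that by (simp add: differentiable_on_eq_differentiable_at)
    then show ?thesis
      by (simp add: DERIV_deriv_iff_real_differentiable)
  qed
  have g2: "g2 t = exp (- s * \<phi> t) * deriv f t" if "t > a" for t
  proof -
    \<comment> \<open>The factor from the conformable derivative cancels the weight of the
      transform.\<close>
    have "(t - a) powr (1 - \<alpha>) * (t - a) powr (\<alpha> - 1) = 1"
      using that by (simp flip: powr_add)
    then show ?thesis
      using conformable_deriv_eq[OF that f_deriv[OF that], of \<alpha>]
      by (simp add: g2_def frac_laplace_integrand_def \<phi>_def)
  qed
  have G_deriv: "(G has_real_derivative g2 t - s * g1 t) (at t)" if "t > a" for t
    unfolding G_def g1 g2[OF that] using that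
    by (auto intro!: derivative_eq_intros \<phi>_deriv f_deriv simp: algebra_simps)
  have \<phi>_right: "(\<phi> \<longlongrightarrow> 0) (at_right a)"
  proof -
    have "((\<lambda>t. (t - a) powr \<alpha>) \<longlongrightarrow> (a - a) powr \<alpha>) (at_right a)"
      using assms(1)
      by (intro tendsto_powr2 tendsto_intros)
         (auto simp: eventually_at_filter)
    then show ?thesis
      unfolding \<phi>_def by (auto intro: tendsto_divide_zero)
  qed
  \<comment> \<open>Since \<open>0 powr \<alpha>\<close> is 0, the phase vanishes at
    \<open>a\<close> and the exponential factor is 1.\<close>
  have "G a = f a"
    by (simp add: G_def \<phi>_def)
  have "(f \<longlongrightarrow> f a) (at_right a)"
    using assms(4) by (simp add: continuous_within)
  with \<phi>_right have "(G \<longlongrightarrow> G a) (at_right a)"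
    unfolding \<open>G a = f a\<close> unfolding G_def by (auto intro!: tendsto_eq_intros)
  \<comment> \<open>The derivative of \<open>G\<close> is known only to the right of
    \<open>a\<close>. The interior form of the fundamental theorem bridges the endpoint by
    continuity of \<open>G\<close> on \<open>{a..x}\<close>, and it yields integrability together
    with the value.\<close>
  have ftc: "((\<lambda>t. g2 t - s * g1 t) has_integral (G x - f a)) {a..x}" if "x > a" for x
  proof -
    have "continuous_on {a..x} G"
      unfolding continuous_on_def
    proof
      fix t assume t: "t \<in> {a..x}"
      show "(G \<longlongrightarrow> G t) (at t within {a..x})"
      proof (cases "t = a")
        case True
        with \<open>(G \<longlongrightarrow> G a) (at_right a)\<close> that show ?thesis
          by (simp add: at_within_Icc_at_right)
      next
        case False
        with t have "isCont G t"
          by (intro DERIV_isCont[OF G_deriv]) auto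
        then have "continuous (at t within {a..x}) G"
          by (rule continuous_at_imp_continuous_at_within)
        then show ?thesis
          by (simp add: continuous_within)
      qed
    qed
    then have "((\<lambda>t. g2 t - s * g1 t) has_integral (G x - G a)) {a..x}"
      using that G_deriv
      by (intro fundamental_theorem_of_calculus_interior)
         (auto simp flip: has_real_derivative_iff_has_vector_derivative)
    then show ?thesis
      by (simp add: \<open>G a = f a\<close>)
  qed
  \<comment> \<open>\<open>L\<close> is the error term of the claim: the theorem is the equation
    \<open>L = 0\<close> rearranged. It is also the limit of \<open>G\<close> at infinity, because
    the same expression over \<open>{a..x}\<close> equals \<open>G x\<close>.\<close>
  define L where "L = f a + (integral {a..} g2 - s * integral {a..} g1)"
  have "((\<lambda>x. f a + (integral {a..x} g2 - s * integral {a..x} g1)) \<longlongrightarrow> L) at_top"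
    unfolding L_def by (intro tendsto_intros tendsto_integral_at_top int1 int2)
  moreover have "\<forall>\<^sub>F x in at_top. f a + (integral {a..x} g2 - s * integral {a..x} g1) = G x"
    using eventually_gt_at_top[of a]
  proof eventually_elim
    case (elim x)
    have "(g1 has_integral integral {a..x} g1) {a..x}" "(g2 has_integral integral {a..x} g2) {a..x}"
      using int1 int2 by (auto intro!: integrable_integral integrable_on_atLeastAtMost_if_atLeast)
    then have "((\<lambda>t. g2 t - s * g1 t) has_integral
        (integral {a..x} g2 - s * integral {a..x} g1)) {a..x}"
      by (intro has_integral_diff has_integral_mult_right)
    then have "integral {a..x} g2 - s * integral {a..x} g1 = G x - f a"
      using ftc[OF elim] by (rule has_integral_unique)
    then show ?case
      by simp
  qed
  ultimately have "(G \<longlongrightarrow> L) at_top"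
    by (rule Lim_transform_eventually)
  moreover have "filterlim \<phi> at_top at_top"
    unfolding \<phi>_def using assms(1) by real_asymp
  moreover have "w t \<ge> 0" for t
    by (simp add: w_def)
  \<comment> \<open>Existence of the transform of \<open>f\<close> is integrability of
    \<open>w * G\<close>, and \<open>w\<close> is the derivative of the unbounded
    \<open>\<phi>\<close>, so \<open>G\<close> can only tend to 0.\<close>
  ultimately have "L = 0"
    using \<phi>_deriv int1[unfolded g1] by (intro limit_eq_0_if_weighted_integrable[of a \<phi> w G])
  then show ?thesis
    by (simp add: L_def frac_laplace_def g1_def g2_def)
qed

end
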